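(* Let $G=(V,E)$ be a finite simple connected graph with adjacency matrix $A_G$, let $\lambda\in\mathbb{R}$ be nonzero, and set $\mathcal{A}_{G,\lambda}=\lambda\operatorname{Id}_V+A_G$, with adjacency blowup-polynomial $p_{\mathcal{A}_{G,\lambda}}$. The following are equivalent: (1) $p_{\mathcal{A}_{G,\lambda}}$ is even in $\mathbf{n}$, i.e. $p_{\mathcal{A}_{G,\lambda}}(-\mathbf{n})\equiv p_{\mathcal{A}_{G,\lambda}}(\mathbf{n})$. (2) $G$ is bipartite.
   Context: The adjacency blowup-polynomial is $p_{\mathcal{A}_{G,\lambda}}(\mathbf{n}):=\det(\lambda\operatorname{Id}_V+\Delta_{\mathbf{n}}A_G)$ in the variables $\mathbf{n}=(n_v)_{v\in V}$, where $\Delta_{\mathbf{n}}:=\operatorname{diag}(n_v)_{v\in V}$. *)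

theory Defs
  imports
    "HOL-Analysis.Determinants"
    "HOL-Library.Poly_Mapping"
    "Graph_Theory.Digraph_Component"
    "Graph_Theory.Pair_Digraph"
begin

text \<open>
  Real polynomials in commuting variables \<open>n\<^sub>v\<close>, one for each \<open>v :: 'v\<close>. A monomial is its finitely
  supported exponent function and a polynomial its finitely supported coefficient function;
  HOL-Library makes this type a commutative ring under convolution.
\<close>

type_synonym 'v mpoly = "('v \<Rightarrow>\<^sub>0 nat) \<Rightarrow>\<^sub>0 real"

definition mconst :: "real \<Rightarrow> 'v mpoly" where
  "mconst c = Poly_Mapping.single 0 c"

definition mvar :: "'v \<Rightarrow> 'v mpoly" where
  "mvar v = Poly_Mapping.single (Poly_Mapping.single v 1) 1"

definition msubst :: "('v \<Rightarrow> 'v mpoly) \<Rightarrow> 'v mpoly \<Rightarrow> 'v mpoly" where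
  "msubst \<sigma> p =
     (\<Sum>m\<in>Poly_Mapping.keys p.
        mconst (Poly_Mapping.lookup p m) *
        (\<Prod>v\<in>Poly_Mapping.keys m. \<sigma> v ^ Poly_Mapping.lookup m v))"

text \<open>
  Simple graphs are the \<open>pair_graph\<close>s of Graph\_Theory: loop-free, with an edge \<open>{u, v}\<close> represented
  by the two arcs \<open>(u, v)\<close> and \<open>(v, u)\<close>. For matrices indexed by vertices the vertex set has to be
  the whole of a finite type, i.e. \<open>pverts G = UNIV\<close>.
\<close>

definition adjacency_matrix :: "'v::finite pair_pre_digraph \<Rightarrow> real^'v^'v" where
  "adjacency_matrix G = (\<chi> u v. if (u, v) \<in> parcs G then 1 else 0)"

text \<open>One of the two parts may be empty, so the one-vertex graph is bipartite.\<close>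

definition bipartite :: "'v pair_pre_digraph \<Rightarrow> bool" where
  "bipartite G \<longleftrightarrow>
     (\<exists>X Y. X \<union> Y = pverts G \<and> X \<inter> Y = {} \<and>
        (\<forall>(u, v)\<in>parcs G. (u \<in> X \<and> v \<in> Y) \<or> (u \<in> Y \<and> v \<in> X)))"

definition diag_matrix :: "('v \<Rightarrow> 'a::zero) \<Rightarrow> 'a^'v^'v" where
  "diag_matrix d = (\<chi> u v. if u = v then d u else 0)"

text \<open>
  \<open>det (\<lambda> Id + \<Delta>\<^sub>n A\<^sub>G)\<close>, with the determinant taken over the polynomial ring.
\<close>

definition adj_blowup_poly :: "real \<Rightarrow> 'v::finite pair_pre_digraph \<Rightarrow> 'v mpoly" where
  "adj_blowup_poly lam G =
     det (mat (mconst lam) + diag_matrix mvar ** map_matrix mconst (adjacency_matrix G))"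

end

theory Submission
  imports Defs "HOL-Analysis.Cartesian_Euclidean_Space"
begin

text \<open>
  If \<open>G\<close> is bipartite, conjugating \<open>\<lambda> Id + \<Delta>\<^sub>n A\<close> by the diagonal matrix that is \<open>1\<close> on one part and
  \<open>-1\<close> on the other changes the sign of \<open>A\<close> and keeps \<open>\<lambda> Id\<close>, so it turns \<open>n\<close> into \<open>- n\<close> without
  changing the determinant. This works over the polynomial ring itself
  (\<open>bipartite_imp_det_blowup_even\<close>).

  The converse is spectral and uses evenness only on the diagonal \<open>n = (t, \<dots>, t)\<close>, where it says
  \<open>det (\<lambda> Id - t A) = det (\<lambda> Id + t A)\<close> for all real \<open>t\<close>. As \<open>\<lambda> \<noteq> 0\<close>, the spectrum of \<open>A\<close> is then
  symmetric about \<open>0\<close>. Let \<open>\<mu>\<close> be the largest eigenvalue, that is, the maximum of the Rayleigh quotient,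
  and let \<open>A y = - \<mu> y\<close> with \<open>y \<noteq> 0\<close>. Because \<open>A\<close> has nonnegative entries, the vector \<open>\<bar>y\<bar>\<close> of absolute
  values has Rayleigh quotient at least \<open>\<mu>\<close>, hence it is a maximizer and \<open>A \<bar>y\<bar> = \<mu> \<bar>y\<bar>\<close>. Comparing the
  two eigenvalue equations row by row forces equality in the triangle inequality, so that \<open>y\<close> changes
  sign along every edge that starts outside its zero set (\<open>opposite_eigenvector_alternates\<close>). By
  connectedness \<open>y\<close> vanishes nowhere, and its positive and negative vertices form a bipartition.

  The passage between polynomials and real matrices is the fact that evaluation is a ring
  homomorphism (\<open>poly_eval_hom\<close>), and ring homomorphisms commute with determinants.
\<close>

section \<open>Evaluation of polynomials\<close>

locale comm_ring_1_hom =
  fixes h :: "'a::comm_ring_1 \<Rightarrow> 'b::comm_ring_1"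
  assumes hom_one: "h 1 = 1"
    and hom_add: "h (a + b) = h a + h b"
    and hom_mult: "h (a * b) = h a * h b"
begin

lemma hom_zero: "h 0 = 0"
  using hom_add[of 0 0] by simp

lemma hom_uminus: "h (- a) = - h a"
  using hom_add[of "- a" a] by (simp add: hom_zero eq_neg_iff_add_eq_0)

lemma hom_sum: "h (sum f S) = (\<Sum>i\<in>S. h (f i))"
  by (induction S rule: infinite_finite_induct) (simp_all add: hom_zero hom_add)

lemma hom_prod: "h (prod f S) = (\<Prod>i\<in>S. h (f i))"
  by (induction S rule: infinite_finite_induct) (simp_all add: hom_one hom_mult)

lemma hom_det:
  fixes A :: "'a^'n^'n"
  shows "h (det A) = det (map_matrix h A)"
proof -
  have "h (of_int (sign p)) = of_int (sign p)" for p :: "'n \<Rightarrow> 'n"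
    by (cases p rule: sign_cases) (simp_all add: hom_one hom_uminus)
  then show ?thesis
    by (simp add: det_def hom_sum hom_mult hom_prod)
qed

end

text \<open>
  The target ring is arbitrary, with \<open>k\<close> embedding the coefficients, so that the same operation covers
  both substitution of polynomials (\<open>k = mconst\<close>) and evaluation at real points (\<open>k\<close> the identity).
\<close>

definition poly_eval :: "(real \<Rightarrow> 'b::comm_ring_1) \<Rightarrow> ('v \<Rightarrow> 'b) \<Rightarrow> 'v mpoly \<Rightarrow> 'b" where
  "poly_eval k x p =
     (\<Sum>m\<in>Poly_Mapping.keys p.
        k (Poly_Mapping.lookup p m) *
        (\<Prod>v\<in>Poly_Mapping.keys m. x v ^ Poly_Mapping.lookup m v))"

lemma msubst_eq_poly_eval: "msubst \<sigma> = poly_eval mconst \<sigma>"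
  by (simp add: fun_eq_iff msubst_def poly_eval_def)

lemma mpoly_eq_sum_monomials:
  "p = (\<Sum>m\<in>Poly_Mapping.keys p. Poly_Mapping.single m (Poly_Mapping.lookup p m))"
  by (rule poly_mapping_eqI)
     (auto simp: lookup_sum lookup_single when_def sum.delta in_keys_iff)

text \<open>
  Index sets that do not depend on \<open>p\<close> and on the monomials are what makes additivity and the product
  of monomials a matter of rearranging sums and products.
\<close>

lemma poly_eval_superset:
  fixes k :: "real \<Rightarrow> 'b::comm_ring_1" and x :: "'v::finite \<Rightarrow> 'b"
  assumes "comm_ring_1_hom k" "finite S" "Poly_Mapping.keys p \<subseteq> S"
  shows "poly_eval k x p =
    (\<Sum>m\<in>S. k (Poly_Mapping.lookup p m) * (\<Prod>v\<in>UNIV. x v ^ Poly_Mapping.lookup m v))"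
proof -
  interpret k: comm_ring_1_hom k by fact
  have "(\<Prod>v\<in>Poly_Mapping.keys m. x v ^ Poly_Mapping.lookup m v)
      = (\<Prod>v\<in>UNIV. x v ^ Poly_Mapping.lookup m v)" for m
    by (rule prod.mono_neutral_left) (auto simp: in_keys_iff)
  then show ?thesis
    unfolding poly_eval_def
    by (simp add: assms sum.mono_neutral_left in_keys_iff k.hom_zero)
qed

lemma poly_eval_hom:
  fixes k :: "real \<Rightarrow> 'b::comm_ring_1" and x :: "'v::finite \<Rightarrow> 'b"
  assumes "comm_ring_1_hom k"
  shows "comm_ring_1_hom (poly_eval k x)"
proof -
  interpret k: comm_ring_1_hom k by fact
  note superset = poly_eval_superset[OF assms]
  have single: "poly_eval k x (Poly_Mapping.single m c)
      = k c * (\<Prod>v\<in>UNIV. x v ^ Poly_Mapping.lookup m v)" for m c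
    by (subst superset[where S = "{m}"]) auto
  have add: "poly_eval k x (p + q) = poly_eval k x p + poly_eval k x q" for p q
    using Poly_Mapping.keys_add[of p q]
    by (simp add: superset[where S = "Poly_Mapping.keys p \<union> Poly_Mapping.keys q"]
        lookup_add k.hom_add distrib_right sum.distrib)
  have zero: "poly_eval k x 0 = 0"
    by (simp add: poly_eval_def)
  have sum: "poly_eval k x (sum f S) = (\<Sum>i\<in>S. poly_eval k x (f i))"
    for f :: "('v \<Rightarrow>\<^sub>0 nat) \<Rightarrow> 'v mpoly" and S
    by (induction S rule: infinite_finite_induct) (simp_all add: zero add)
  have monomial_mult: "poly_eval k x (Poly_Mapping.single m c * Poly_Mapping.single n d)
      = poly_eval k x (Poly_Mapping.single m c) * poly_eval k x (Poly_Mapping.single n d)" for m n c d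
    by (simp add: mult_single single k.hom_mult lookup_add power_add prod.distrib ac_simps)
  have mult: "poly_eval k x (p * q) = poly_eval k x p * poly_eval k x q" for p q
  proof -
    let ?t = "\<lambda>p m. Poly_Mapping.single m (Poly_Mapping.lookup p m)"
    let ?K = "Poly_Mapping.keys"
    have expand: "poly_eval k x r = (\<Sum>m\<in>?K r. poly_eval k x (?t r m))" for r
      by (subst (1) mpoly_eq_sum_monomials) (rule sum)
    have "p * q = (\<Sum>m\<in>?K p. ?t p m) * (\<Sum>n\<in>?K q. ?t q n)"
      by (simp only: mpoly_eq_sum_monomials[symmetric])
    then have "poly_eval k x (p * q)
        = (\<Sum>m\<in>?K p. \<Sum>n\<in>?K q. poly_eval k x (?t p m) * poly_eval k x (?t q n))"
      by (simp only: sum_product sum monomial_mult)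
    also have "\<dots> = poly_eval k x p * poly_eval k x q"
      by (simp only: sum_product[symmetric] expand[symmetric])
    finally show ?thesis .
  qed
  have "poly_eval k x 1 = 1"
    using single[of 0 1] by (simp add: k.hom_one)
  then show ?thesis
    by unfold_locales (simp_all add: add mult)
qed

lemma poly_eval_mconst:
  "comm_ring_1_hom k \<Longrightarrow> poly_eval k x (mconst c) = k c"
  by (cases "c = 0") (simp_all add: poly_eval_def mconst_def comm_ring_1_hom.hom_zero)

lemma poly_eval_mvar:
  "comm_ring_1_hom k \<Longrightarrow> poly_eval k x (mvar v) = x v"
  by (simp add: poly_eval_def mvar_def comm_ring_1_hom.hom_one)

lemma mconst_hom: "comm_ring_1_hom mconst"
  by unfold_locales (simp_all add: mconst_def single_add mult_single)

lemma ident_hom: "comm_ring_1_hom (\<lambda>c. c)"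
  by unfold_locales simp_all

section \<open>The blowup determinant\<close>

definition blowup_matrix ::
    "(real \<Rightarrow> 'b::comm_ring_1) \<Rightarrow> real \<Rightarrow> ('v \<Rightarrow> 'b) \<Rightarrow> real^'v^'v \<Rightarrow> 'b^'v^'v" where
  "blowup_matrix k lam n A =
     (\<chi> u v. (if u = v then k lam else 0) + n u * k (A $ u $ v))"

lemma (in comm_ring_1_hom) hom_det_blowup_matrix:
  "h (det (blowup_matrix k lam n A)) = det (blowup_matrix (\<lambda>c. h (k c)) lam (\<lambda>v. h (n v)) A)"
proof -
  have "map_matrix h (blowup_matrix k lam n A)
      = blowup_matrix (\<lambda>c. h (k c)) lam (\<lambda>v. h (n v)) A"
    by (simp add: blowup_matrix_def vec_eq_iff hom_add hom_mult hom_zero)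
  then show ?thesis by (simp add: hom_det)
qed

lemma diag_matrix_mult_entry:
  fixes d :: "'v::finite \<Rightarrow> 'a::semiring_1"
  shows "(diag_matrix d ** M) $ u $ v = d u * M $ u $ v"
  by (simp add: matrix_matrix_mult_def diag_matrix_def if_distrib[of "\<lambda>c. c * _"] eq_commute
      cong: if_cong)

lemma adj_blowup_poly_eq:
  "adj_blowup_poly lam G = det (blowup_matrix mconst lam mvar (adjacency_matrix G))"
  unfolding adj_blowup_poly_def
  by (rule arg_cong[where f = det])
     (simp add: blowup_matrix_def mat_def vec_eq_iff diag_matrix_mult_entry)

lemma poly_eval_adj_blowup_poly:
  assumes k: "comm_ring_1_hom k"
  shows "poly_eval k x (adj_blowup_poly lam G) = det (blowup_matrix k lam x (adjacency_matrix G))"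
proof -
  interpret e: comm_ring_1_hom "poly_eval k x"
    using k by (rule poly_eval_hom)
  show ?thesis
    by (simp add: adj_blowup_poly_eq e.hom_det_blowup_matrix poly_eval_mconst[OF k]
        poly_eval_mvar[OF k])
qed

text \<open>
  In every Leibniz term each sign occurs twice, once for its row and once for its column, and so
  cancels.
\<close>

lemma det_sign_conjugate:
  fixes M :: "'b::comm_ring_1^'v^'v"
  assumes s: "\<And>u. s u * s u = 1"
  shows "det (\<chi> u v. s u * s v * M $ u $ v) = det M"
proof -
  have "(\<Prod>u\<in>UNIV. s u * s (p u) * M $ u $ p u) = (\<Prod>u\<in>UNIV. M $ u $ p u)"
    if "p permutes UNIV" for p
  proof -
    have "(\<Prod>u\<in>UNIV. s (p u)) = prod s UNIV"
      using prod.permute[OF that, of s] by (simp add: o_def)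
    then have "(\<Prod>u\<in>UNIV. s u * s (p u)) = (\<Prod>u\<in>UNIV. s u * s u)"
      by (simp add: prod.distrib)
    then show ?thesis
      by (simp add: prod.distrib[of "\<lambda>u. s u * s (p u)"] s)
  qed
  then show ?thesis
    by (simp add: det_def)
qed

lemma bipartite_imp_det_blowup_even:
  assumes "bipartite G" "pverts G = UNIV" and k: "comm_ring_1_hom k"
  shows "det (blowup_matrix k lam (\<lambda>v. - n v) (adjacency_matrix G))
    = det (blowup_matrix k lam n (adjacency_matrix G))"
proof -
  interpret k: comm_ring_1_hom k by fact
  obtain X Y where XY: "X \<inter> Y = {}"
    and "\<forall>(u, v)\<in>parcs G. (u \<in> X \<and> v \<in> Y) \<or> (u \<in> Y \<and> v \<in> X)"
    using \<open>bipartite G\<close> unfolding bipartite_def by (elim exE conjE)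
  then have arcs: "(u \<in> X \<and> v \<in> Y) \<or> (u \<in> Y \<and> v \<in> X)" if "(u, v) \<in> parcs G" for u v
    using that by auto
  define s where "s u = (if u \<in> X then 1 else - 1 :: 'b)" for u
  have "blowup_matrix k lam (\<lambda>v. - n v) (adjacency_matrix G)
      = (\<chi> u v. s u * s v * blowup_matrix k lam n (adjacency_matrix G) $ u $ v)"
    using XY by (auto simp: blowup_matrix_def adjacency_matrix_def vec_eq_iff s_def
        k.hom_zero k.hom_one dest!: arcs)
  then show ?thesis
    by (simp add: det_sign_conjugate s_def)
qed

section \<open>Extremal eigenvectors of symmetric matrices\<close>

lemma symmetric_matrix_inner_commute:
  fixes A :: "real^'n^'n"
  assumes "transpose A = A"
  shows "(A *v x) \<bullet> y = x \<bullet> (A *v y)"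
  by (metis assms dot_lmul_matrix transpose_matrix_vector)

text \<open>
  A null vector minimizes the quadratic form, so the gradient vanishes there: otherwise a short step
  against the gradient direction \<open>M x\<close> would make the form negative.
\<close>

lemma psd_null_vector_in_kernel:
  fixes M :: "real^'n^'n"
  assumes sym: "transpose M = M" and psd: "\<And>x. 0 \<le> x \<bullet> (M *v x)" and null: "x \<bullet> (M *v x) = 0"
  shows "M *v x = 0"
proof (rule ccontr)
  assume "M *v x \<noteq> 0"
  define w where "w = M *v x"
  define a where "a = w \<bullet> w"
  define b where "b = w \<bullet> (M *v w)"
  have "a > 0" using \<open>M *v x \<noteq> 0\<close> by (simp add: a_def w_def)
  have "b \<ge> 0" using psd by (simp add: b_def)
  have expand: "(x - t *\<^sub>R w) \<bullet> (M *v (x - t *\<^sub>R w)) = t\<^sup>2 * b - 2 * t * a" for t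
    using null symmetric_matrix_inner_commute[OF sym, of x w]
    by (simp add: matrix_vector_mult_diff_distrib matrix_vector_mult_scaleR inner_diff_left
        inner_diff_right a_def b_def w_def[symmetric] inner_commute power2_eq_square algebra_simps)
  \<comment> \<open>The minimum is at \<open>t = a / b\<close>; the added \<open>1\<close> covers \<open>b = 0\<close> and keeps \<open>t\<close> below the root \<open>2 a / b\<close>.\<close>
  define t where "t = a / (b + 1)"
  have "t > 0" using \<open>a > 0\<close> \<open>b \<ge> 0\<close> by (simp add: t_def)
  have "t * b \<le> a"
    using \<open>a > 0\<close> \<open>b \<ge> 0\<close> by (simp add: t_def field_simps)
  then have "t\<^sup>2 * b - 2 * t * a < 0"
    using \<open>t > 0\<close> \<open>a > 0\<close> mult_left_mono[of "t * b" a t] by (simp add: power2_eq_square algebra_simps)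
  then show False
    using psd[of "x - t *\<^sub>R w"] expand[of t] by linarith
qed

text \<open>The matrix \<open>\<mu> Id - A\<close> is positive semidefinite and \<open>x\<close> is a null vector of its form.\<close>

lemma rayleigh_maximizer_is_eigenvector:
  fixes A :: "real^'n^'n"
  assumes sym: "transpose A = A"
    and max: "\<And>z. z \<bullet> (A *v z) \<le> \<mu> * (z \<bullet> z)" and eq: "x \<bullet> (A *v x) = \<mu> * (x \<bullet> x)"
  shows "A *v x = \<mu> *\<^sub>R x"
proof -
  define M where "M = mat \<mu> - A"
  have M: "M *v z = \<mu> *\<^sub>R z - A *v z" for z
  proof -
    have "mat \<mu> *v z = \<mu> *\<^sub>R z"
      by (simp add: vec_eq_iff matrix_vector_mult_def mat_def if_distrib[of "\<lambda>c. c * _"] cong: if_cong)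
    then show ?thesis by (simp add: M_def matrix_vector_mult_diff_rdistrib)
  qed
  have "transpose M = M"
    using sym by (auto simp: M_def transpose_def vec_eq_iff mat_def)
  then have "M *v x = 0"
    using max eq by (intro psd_null_vector_in_kernel) (simp_all add: M inner_diff_right)
  then show ?thesis by (simp add: M)
qed

lemma symmetric_matrix_top_eigenvector:
  fixes A :: "real^'n^'n"
  assumes sym: "transpose A = A"
  obtains \<mu> x where "x \<noteq> 0" "A *v x = \<mu> *\<^sub>R x" "\<And>z. z \<bullet> (A *v z) \<le> \<mu> * (z \<bullet> z)"
proof -
  have "axis undefined 1 \<in> sphere (0::real^'n) 1"
    by (simp add: dist_norm norm_axis_1)
  then have "sphere (0::real^'n) 1 \<noteq> {}" by blast
  moreover have "compact (sphere (0::real^'n) 1)" by simp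
  moreover have "continuous_on (sphere 0 1) (\<lambda>z. z \<bullet> (A *v z))"
    by (intro continuous_intros)
  ultimately obtain x where x: "norm x = 1"
    and max1: "\<And>z. norm z = 1 \<Longrightarrow> z \<bullet> (A *v z) \<le> x \<bullet> (A *v x)"
    using continuous_attains_sup[of "sphere 0 1" "\<lambda>z. z \<bullet> (A *v z)"] by (auto simp: dist_norm)
  define \<mu> where "\<mu> = x \<bullet> (A *v x)"
  have max: "z \<bullet> (A *v z) \<le> \<mu> * (z \<bullet> z)" for z
  proof (cases "z = 0")
    case False
    have "sgn z \<bullet> (A *v sgn z) \<le> \<mu>"
      using max1[of "sgn z"] False by (simp add: \<mu>_def norm_sgn)
    then have "(z \<bullet> (A *v z)) / (norm z)\<^sup>2 \<le> \<mu>"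
      by (simp add: sgn_div_norm matrix_vector_mult_scaleR power2_eq_square divide_inverse ac_simps)
    then show ?thesis
      using False by (simp add: field_simps dot_square_norm)
  qed simp
  have "x \<bullet> x = 1" using x by (simp add: dot_square_norm)
  then have "A *v x = \<mu> *\<^sub>R x"
    using sym max by (intro rayleigh_maximizer_is_eigenvector) (simp_all add: \<mu>_def)
  moreover have "x \<noteq> 0" using x by auto
  ultimately show ?thesis using that max by blast
qed

text \<open>
  The part of Perron--Frobenius theory that is needed here. Since \<open>\<bar>y\<bar>\<close> attains the maximal Rayleigh
  quotient \<open>\<mu>\<close>, it is an eigenvector too. Adding its row \<open>i\<close> to row \<open>i\<close> of \<open>A y = - \<mu> y\<close>, the latter
  multiplied by the sign of \<open>y\<^sub>i\<close>, leaves a vanishing sum of nonnegative terms.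
\<close>

lemma opposite_eigenvector_alternates:
  fixes A :: "real^'n^'n" and y :: "real^'n"
  assumes sym: "transpose A = A" and nonneg: "\<And>u v. 0 \<le> A $ u $ v"
    and max: "\<And>z. z \<bullet> (A *v z) \<le> \<mu> * (z \<bullet> z)"
    and y: "A *v y = - \<mu> *\<^sub>R y"
    and edge: "A $ u $ v > 0" and "y $ u \<noteq> 0"
  shows "y $ u * y $ v < 0"
proof -
  define a where "a = (\<chi> i. \<bar>y $ i\<bar>)"
  have "a \<bullet> a = y \<bullet> y"
    by (simp add: a_def inner_vec_def)
  \<comment> \<open>The Rayleigh quotient of \<open>a\<close> is at least \<open>\<mu>\<close>, by the triangle inequality.\<close>
  have "\<mu> * (y \<bullet> y) = - (y \<bullet> (A *v y))"
    by (simp add: y)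
  also have "\<dots> = (\<Sum>i\<in>UNIV. \<Sum>j\<in>UNIV. - (y $ i * (A $ i $ j * y $ j)))"
    by (simp add: inner_vec_def matrix_vector_mult_def sum_distrib_left sum_negf)
  also have "\<dots> \<le> (\<Sum>i\<in>UNIV. \<Sum>j\<in>UNIV. a $ i * (A $ i $ j * a $ j))"
  proof (intro sum_mono)
    fix i j
    have "- (y $ i * (A $ i $ j * y $ j)) \<le> \<bar>y $ i * (A $ i $ j * y $ j)\<bar>" by simp
    then show "- (y $ i * (A $ i $ j * y $ j)) \<le> a $ i * (A $ i $ j * a $ j)"
      using nonneg[of i j] by (simp add: a_def abs_mult)
  qed
  also have "\<dots> = a \<bullet> (A *v a)"
    by (simp add: inner_vec_def matrix_vector_mult_def sum_distrib_left)
  finally have "a \<bullet> (A *v a) = \<mu> * (a \<bullet> a)"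
    using max[of a] \<open>a \<bullet> a = y \<bullet> y\<close> by simp
  then have "A *v a = \<mu> *\<^sub>R a"
    using sym max by (rule rayleigh_maximizer_is_eigenvector[rotated -1])
  then have a_row: "(\<Sum>j\<in>UNIV. A $ i $ j * a $ j) = \<mu> * \<bar>y $ i\<bar>" for i
    by (simp add: vec_eq_iff matrix_vector_mult_def a_def)
  have y_row: "(\<Sum>j\<in>UNIV. A $ i $ j * y $ j) = - \<mu> * y $ i" for i
    using y by (simp add: vec_eq_iff matrix_vector_mult_def)
  have opposite: "\<bar>y $ j\<bar> + sgn (y $ i) * y $ j = 0" if "A $ i $ j > 0" for i j
  proof (cases "y $ i = 0")
    case True
    have "(\<Sum>j\<in>UNIV. A $ i $ j * a $ j) = 0"
      by (simp add: a_row True)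
    then have "A $ i $ j * a $ j = 0"
      using nonneg by (subst (asm) sum_nonneg_eq_0_iff) (auto simp: a_def)
    with that True show ?thesis by (simp add: a_def)
  next
    case False
    let ?f = "\<lambda>j. A $ i $ j * (\<bar>y $ j\<bar> + sgn (y $ i) * y $ j)"
    have "sum ?f UNIV
        = (\<Sum>j\<in>UNIV. A $ i $ j * a $ j) + sgn (y $ i) * (\<Sum>j\<in>UNIV. A $ i $ j * y $ j)"
      by (simp add: a_def algebra_simps sum.distrib sum_distrib_left)
    also have "\<dots> = 0"
      by (simp add: a_row y_row abs_sgn)
    finally have "sum ?f UNIV = 0" .
    moreover have "0 \<le> ?f j" for j
      using nonneg[of i j] by (intro mult_nonneg_nonneg) (auto simp: sgn_if)
    ultimately have "?f j = 0"
      by (subst (asm) sum_nonneg_eq_0_iff) auto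
    with that show ?thesis by simp
  qed
  \<comment> \<open>A zero at \<open>v\<close> would spread back to \<open>u\<close> along the reversed edge.\<close>
  have "transpose A $ v $ u > 0"
    using edge by (simp add: transpose_def)
  then have "A $ v $ u > 0"
    by (simp only: sym)
  then have "y $ v \<noteq> 0"
    using opposite[of v u] \<open>y $ u \<noteq> 0\<close> by auto
  then show ?thesis
    using opposite[OF edge] \<open>y $ u \<noteq> 0\<close> by (auto simp: sgn_if mult_less_0_iff split: if_splits)
qed

lemma det_eq_0_iff_kernel:
  fixes B :: "real^'n^'n"
  shows "det B = 0 \<longleftrightarrow> (\<exists>x. x \<noteq> 0 \<and> B *v x = 0)"
  using invertible_det_nz[of B] invertible_left_inverse[of B] matrix_left_invertible_ker[of B] by auto

lemma blowup_matrix_const_mult_vec: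
  "blowup_matrix (\<lambda>c. c) lam (\<lambda>v. t) A *v x = lam *\<^sub>R x + t *\<^sub>R (A *v x)"
  by (simp add: vec_eq_iff blowup_matrix_def matrix_vector_mult_def distrib_right sum.distrib
      sum_distrib_left mult.assoc if_distrib[of "\<lambda>c. c * _"] cong: if_cong)

text \<open>
  For \<open>\<mu> \<noteq> 0\<close>, the vector \<open>x\<close> makes \<open>\<lambda> Id + t A\<close> singular at \<open>t = - \<lambda> / \<mu>\<close>, so evenness makes it
  singular at \<open>t = \<lambda> / \<mu>\<close> as well, and a kernel vector there has eigenvalue \<open>- \<mu>\<close>.
\<close>

lemma even_imp_opposite_eigenvector:
  fixes A :: "real^'n^'n"
  assumes even: "\<And>t. det (blowup_matrix (\<lambda>c. c) lam (\<lambda>v. - t) A)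
      = det (blowup_matrix (\<lambda>c. c) lam (\<lambda>v. t) A)"
    and "lam \<noteq> 0" and x: "x \<noteq> 0" "A *v x = \<mu> *\<^sub>R x"
  obtains y where "y \<noteq> 0" "A *v y = - \<mu> *\<^sub>R y"
proof (cases "\<mu> = 0")
  case True
  then show ?thesis using that[of x] x by simp
next
  case False
  have "det (blowup_matrix (\<lambda>c. c) lam (\<lambda>v. - (lam / \<mu>)) A) = 0"
    using x False by (auto simp: det_eq_0_iff_kernel blowup_matrix_const_mult_vec)
  then obtain y where "y \<noteq> 0" and y: "lam *\<^sub>R y + (lam / \<mu>) *\<^sub>R (A *v y) = 0"
    by (auto simp: even det_eq_0_iff_kernel blowup_matrix_const_mult_vec)
  have "(lam / \<mu>) *\<^sub>R (A *v y + \<mu> *\<^sub>R y) = 0"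
    using y False by (simp add: scaleR_add_right add.commute)
  then have "A *v y = - \<mu> *\<^sub>R y"
    using False \<open>lam \<noteq> 0\<close> by (simp add: eq_neg_iff_add_eq_0)
  with \<open>y \<noteq> 0\<close> show ?thesis by (rule that)
qed

section \<open>Evenness characterises bipartite graphs\<close>

lemma alternating_vector_imp_bipartite:
  fixes G :: "'v::finite pair_pre_digraph" and y :: "'v \<Rightarrow> real"
  assumes "pair_graph G" and V: "pverts G = UNIV"
    and conn: "Digraph_Component.connected (with_proj G)"
    and alt: "\<And>u v. (u, v) \<in> parcs G \<Longrightarrow> y u \<noteq> 0 \<Longrightarrow> y u * y v < 0"
    and "y r \<noteq> 0"
  shows "bipartite G"
proof -
  interpret pair_graph G by fact
  have "strongly_connected (with_proj G)"
    using symmetric_connected_imp_strongly_connected[OF sym_arcs conn] .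
  then have "r \<rightarrow>\<^sup>*\<^bsub>with_proj G\<^esub> v" for v
    using V by (simp add: strongly_connected_def)
  moreover have "y v \<noteq> 0" if "r \<rightarrow>\<^sup>*\<^bsub>with_proj G\<^esub> v" for v
    using that
  proof (induction rule: reachable_induct)
    case base
    show ?case by fact
  next
    case (step u v)
    then show ?case using alt[of u v] by auto
  qed
  ultimately have "y v \<noteq> 0" for v by blast
  then show ?thesis
    unfolding bipartite_def V using alt
    by (intro exI[of _ "{v. y v > 0}"] exI[of _ "{v. y v < 0}"])
       (auto simp: mult_less_0_iff not_less order_le_less)
qed

theorem proposition4p2:
  fixes G :: "'v::finite pair_pre_digraph" and lam :: real
  assumes "pair_graph G"
    and "pverts G = UNIV"
    and "Digraph_Component.connected (with_proj G)"
    and "lam \<noteq> 0"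
  shows "msubst (\<lambda>v. - mvar v) (adj_blowup_poly lam G) = adj_blowup_poly lam G
    \<longleftrightarrow> bipartite G"
proof -
  let ?A = "adjacency_matrix G"
  have subst: "msubst (\<lambda>v. - mvar v) (adj_blowup_poly lam G)
      = det (blowup_matrix mconst lam (\<lambda>v. - mvar v) ?A)"
    by (simp add: msubst_eq_poly_eval poly_eval_adj_blowup_poly mconst_hom)
  show ?thesis
  proof
    assume "bipartite G"
    then show "msubst (\<lambda>v. - mvar v) (adj_blowup_poly lam G) = adj_blowup_poly lam G"
      unfolding subst unfolding adj_blowup_poly_eq
      using assms mconst_hom by (intro bipartite_imp_det_blowup_even)
  next
    assume poly_even: "msubst (\<lambda>v. - mvar v) (adj_blowup_poly lam G) = adj_blowup_poly lam G"
    interpret pair_graph G by fact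
    have even: "det (blowup_matrix (\<lambda>c. c) lam (\<lambda>v. - t) ?A)
        = det (blowup_matrix (\<lambda>c. c) lam (\<lambda>v. t) ?A)" for t
    proof -
      interpret e: comm_ring_1_hom "poly_eval (\<lambda>c. c) (\<lambda>v::'v. t)"
        by (intro poly_eval_hom ident_hom)
      have "poly_eval (\<lambda>c. c) (\<lambda>v. t) (det (blowup_matrix mconst lam (\<lambda>v. - mvar v) ?A))
          = det (blowup_matrix (\<lambda>c. c) lam (\<lambda>v. - t) ?A)"
        by (simp add: e.hom_det_blowup_matrix e.hom_uminus poly_eval_mconst[OF ident_hom]
            poly_eval_mvar[OF ident_hom])
      then show ?thesis
        using poly_even by (simp add: subst poly_eval_adj_blowup_poly[OF ident_hom])
    qed
    have sym: "transpose ?A = ?A"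
      using sym_arcs by (auto simp: transpose_def adjacency_matrix_def vec_eq_iff symmetric_def dest: symD)
    obtain \<mu> x where "x \<noteq> 0" "?A *v x = \<mu> *\<^sub>R x"
      and max: "\<And>z. z \<bullet> (?A *v z) \<le> \<mu> * (z \<bullet> z)"
      using symmetric_matrix_top_eigenvector[OF sym] by blast
    then obtain y where "y \<noteq> 0" and y: "?A *v y = - \<mu> *\<^sub>R y"
      using even_imp_opposite_eigenvector[OF even \<open>lam \<noteq> 0\<close>] by blast
    then obtain r where "y $ r \<noteq> 0"
      by (auto simp: vec_eq_iff)
    moreover have "y $ u * y $ v < 0" if "(u, v) \<in> parcs G" "y $ u \<noteq> 0" for u v
      using that by (intro opposite_eigenvector_alternates[OF sym _ max y])
        (simp_all add: adjacency_matrix_def)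
    ultimately show "bipartite G"
      using assms by (intro alternating_vector_imp_bipartite[where y = "\<lambda>v. y $ v"]) auto
  qed
qed

end
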